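(* Let $\mathcal{M}$ be a countable metric space in which every distance is $0$, $1/2$, or $1$, and suppose $G_{\mathcal{M}}$ is a comparability graph. Then $\mathcal{M}$ is isometrically embeddable in $(\mathcal{D},H)$.
   Context: $\mathcal{D}$ is the set of Turing degrees. For $X\subseteq\omega$, $\rho_n(X)=|X\cap[0,n)|/n$, $\overline{\rho}(X)=\limsup_n\rho_n(X)$; coarse similarity classes $[X]$ (where $X\sim Y$ iff $\lim_n\rho_n(X\bigtriangleup Y)=0$) form the metric space $(\mathcal{S},\delta)$ with $\delta([X],[Y])=\overline{\rho}(X\bigtriangleup Y)$. For degrees $\mathbf{d},\mathbf{e}$, $H(\mathbf{d},\mathbf{e})$ is the Hausdorff distance in $(\mathcal{S},\delta)$ between the closures of $\{[X]:X\le_T\mathbf{d}\}$ and $\{[X]:X\le_T\mathbf{e}\}$; this is a metric on $\mathcal{D}$. For a metric space $\mathcal{M}$ with distances in $\{0,1/2,1\}$, $G_{\mathcal{M}}$ is the graph whose vertices are the points of $\mathcal{M}$, with an edge between $x$ and $y$ iff their distance is $1$. A graph $(V,E)$ is a comparability graph if there is a partial order $\preccurlyeq$ on $V$ such that $E(x,y)$ holds iff $x\prec y$ or $y\prec x$. *)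

theory Defs
  imports "HOL-Analysis.Analysis"
begin

section \<open>Turing degrees\<close>

text \<open>Relative computability is Kleene's: partial recursive functions of several
  arguments, with the characteristic function of the oracle as an additional initial
  function. \<open>Prec\<close> recurses on the first argument, \<open>Mu\<close> searches for the first argument.\<close>

datatype prog =
    Zero
  | Succ
  | Proj nat
  | Oracle
  | Comp prog "prog list"
  | Prec prog prog
  | Mu prog

text \<open>\<open>evals A p xs y\<close>: program \<open>p\<close> with oracle \<open>A\<close> converges on \<open>xs\<close> with value \<open>y\<close>.\<close>

inductive evals :: "nat set \<Rightarrow> prog \<Rightarrow> nat list \<Rightarrow> nat \<Rightarrow> bool" for A :: "nat set" where
  evals_Zero: "evals A Zero xs 0"
| evals_Succ: "evals A Succ [x] (Suc x)"
| evals_Proj: "i < length xs \<Longrightarrow> evals A (Proj i) xs (xs ! i)"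
| evals_Oracle: "evals A Oracle [x] (of_bool (x \<in> A))"
| evals_Comp: "list_all2 (\<lambda>q y. evals A q xs y) qs ys \<Longrightarrow> evals A p ys z \<Longrightarrow>
    evals A (Comp p qs) xs z"
| evals_Prec_0: "evals A p xs y \<Longrightarrow> evals A (Prec p q) (0 # xs) y"
| evals_Prec_Suc: "evals A (Prec p q) (n # xs) y \<Longrightarrow> evals A q (n # y # xs) z \<Longrightarrow>
    evals A (Prec p q) (Suc n # xs) z"
| evals_Mu: "evals A p (n # xs) 0 \<Longrightarrow> (\<forall>m<n. \<exists>k. evals A p (m # xs) (Suc k)) \<Longrightarrow>
    evals A (Mu p) xs n"

inductive_cases evals_ZeroE: "evals A Zero xs y"
inductive_cases evals_SuccE: "evals A Succ xs y"
inductive_cases evals_ProjE: "evals A (Proj i) xs y"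
inductive_cases evals_OracleE: "evals A Oracle xs y"
inductive_cases evals_CompE: "evals A (Comp p qs) xs y"
inductive_cases evals_Prec_0E: "evals A (Prec p q) (0 # xs) y"
inductive_cases evals_Prec_SucE: "evals A (Prec p q) (Suc n # xs) y"
inductive_cases evals_MuE: "evals A (Mu p) xs y"

lemma evals_deterministic: "evals A p xs y \<Longrightarrow> evals A p xs z \<Longrightarrow> y = z"
proof (induction arbitrary: z rule: evals.induct)
  case (evals_Comp xs qs ys p z')
  from evals_Comp.prems obtain ys'
    where ys': "list_all2 (\<lambda>q y. evals A q xs y) qs ys'" "evals A p ys' z"
    by (rule evals_CompE)
  have "ys = ys'"
    using evals_Comp.IH(1) ys'(1) by (auto simp: list_all2_conv_all_nth intro!: nth_equalityI)
  with ys'(2) evals_Comp.IH(2) show ?case by simp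
next
  case (evals_Prec_Suc p q n xs y z')
  from evals_Prec_Suc.prems show ?case
    by (rule evals_Prec_SucE) (use evals_Prec_Suc.IH in blast)
next
  case (evals_Mu p n xs)
  from evals_Mu.prems have z: "evals A p (z # xs) 0" "\<forall>m<z. \<exists>k. evals A p (m # xs) (Suc k)"
    by (auto elim: evals_MuE)
  show ?case
    using z evals_Mu.IH by (metis nat.distinct(1) nat_neq_iff)
qed (blast elim: evals_ZeroE evals_SuccE evals_ProjE evals_OracleE evals_Prec_0E)+

definition turing_le :: "nat set \<Rightarrow> nat set \<Rightarrow> bool" (infix \<open>\<le>\<^sub>T\<close> 50) where
  "A \<le>\<^sub>T B \<longleftrightarrow> (\<exists>p. \<forall>x. evals B p [x] (of_bool (x \<in> A)))"

lemma turing_le_refl: "A \<le>\<^sub>T A"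
  unfolding turing_le_def using evals_Oracle by blast

primrec subst_oracle :: "prog \<Rightarrow> prog \<Rightarrow> prog" where
  "subst_oracle r Zero = Zero"
| "subst_oracle r Succ = Succ"
| "subst_oracle r (Proj i) = Proj i"
| "subst_oracle r Oracle = r"
| "subst_oracle r (Comp p qs) = Comp (subst_oracle r p) (map (subst_oracle r) qs)"
| "subst_oracle r (Prec p q) = Prec (subst_oracle r p) (subst_oracle r q)"
| "subst_oracle r (Mu p) = Mu (subst_oracle r p)"

lemma evals_subst_oracle:
  assumes "\<And>x. evals B r [x] (of_bool (x \<in> A))"
  shows "evals A p xs y \<Longrightarrow> evals B (subst_oracle r p) xs y"
proof (induction rule: evals.induct)
  case (evals_Comp xs qs ys p z)
  have "list_all2 (\<lambda>q y. evals B q xs y) (map (subst_oracle r) qs) ys"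
    using evals_Comp.IH(1) by (auto simp: list_all2_conv_all_nth)
  then show ?case using evals_Comp.IH(2) by (auto intro: evals.evals_Comp)
next
  case (evals_Mu p n xs)
  then show ?case by (simp, intro evals.evals_Mu) blast+
qed (use assms in \<open>auto intro: evals.intros\<close>)

lemma turing_le_trans:
  assumes "A \<le>\<^sub>T B" "B \<le>\<^sub>T C" shows "A \<le>\<^sub>T C"
  using assms evals_subst_oracle unfolding turing_le_def by meson

definition turing_equiv :: "nat set \<Rightarrow> nat set \<Rightarrow> bool" where
  "turing_equiv A B \<longleftrightarrow> A \<le>\<^sub>T B \<and> B \<le>\<^sub>T A"

lemma equivp_turing_equiv: "equivp turing_equiv"
  by (rule equivpI)
    (auto simp: reflp_def symp_def transp_def turing_equiv_def
      intro: turing_le_refl turing_le_trans)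

quotient_type tdegree = "nat set" / turing_equiv morphisms rep_tdegree deg
  by (rule equivp_turing_equiv)

instantiation tdegree :: order
begin

lift_definition less_eq_tdegree :: "tdegree \<Rightarrow> tdegree \<Rightarrow> bool" is turing_le
  unfolding turing_equiv_def using turing_le_trans by blast

definition less_tdegree :: "tdegree \<Rightarrow> tdegree \<Rightarrow> bool" where
  "less_tdegree d e \<longleftrightarrow> d \<le> e \<and> \<not> e \<le> d"

instance
proof
  fix x y z :: tdegree
  show "x < y \<longleftrightarrow> x \<le> y \<and> \<not> y \<le> x" by (rule less_tdegree_def)
  show "x \<le> x" by transfer (rule turing_le_refl)
  show "x \<le> y \<Longrightarrow> y \<le> z \<Longrightarrow> x \<le> z" by transfer (rule turing_le_trans)
  show "x \<le> y \<Longrightarrow> y \<le> x \<Longrightarrow> x = y" by transfer (simp add: turing_equiv_def)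
qed

end

section \<open>Coarse similarity\<close>

text \<open>For \<open>n = 0\<close> this is \<open>0 / 0 = 0\<close>, which does not affect any limit.\<close>

definition density_upto :: "nat \<Rightarrow> nat set \<Rightarrow> real" where
  "density_upto n X = real (card (X \<inter> {0..<n})) / real n"

text \<open>The limit superior is formed in the extended reals; as \<open>density_upto n X\<close> lies
  in \<open>[0, 1]\<close> it is finite.\<close>

definition upper_density :: "nat set \<Rightarrow> real" where
  "upper_density X = real_of_ereal (limsup (\<lambda>n. ereal (density_upto n X)))"

definition coarse_similar :: "nat set \<Rightarrow> nat set \<Rightarrow> bool" where
  "coarse_similar X Y \<longleftrightarrow> (\<lambda>n. density_upto n (sym_diff X Y)) \<longlonglongrightarrow> 0"

lemma density_upto_nonneg: "0 \<le> density_upto n X"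
  by (simp add: density_upto_def)

lemma density_upto_le_1: "density_upto n X \<le> 1"
proof -
  have "card (X \<inter> {0..<n}) \<le> card {0..<n}" by (intro card_mono) auto
  then show ?thesis by (simp add: density_upto_def divide_le_eq)
qed

lemma density_upto_Un_le:
  assumes "Z \<subseteq> X \<union> Y" shows "density_upto n Z \<le> density_upto n X + density_upto n Y"
proof -
  have "card (Z \<inter> {0..<n}) \<le> card ((X \<inter> {0..<n}) \<union> (Y \<inter> {0..<n}))"
    using assms by (intro card_mono) auto
  also have "\<dots> \<le> card (X \<inter> {0..<n}) + card (Y \<inter> {0..<n})" by (rule card_Un_le)
  finally have "real (card (Z \<inter> {0..<n})) \<le> real (card (X \<inter> {0..<n})) + real (card (Y \<inter> {0..<n}))"
    by linarith
  then show ?thesis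
    unfolding density_upto_def add_divide_distrib [symmetric] by (intro divide_right_mono) auto
qed

lemma limsup_density_bounds:
  "0 \<le> limsup (\<lambda>n. ereal (density_upto n X))" "limsup (\<lambda>n. ereal (density_upto n X)) \<le> 1"
proof -
  have "0 \<le> liminf (\<lambda>n. ereal (density_upto n X))"
    by (intro Liminf_bounded always_eventually) (simp add: density_upto_nonneg)
  also have "\<dots> \<le> limsup (\<lambda>n. ereal (density_upto n X))" by (intro Liminf_le_Limsup) simp
  finally show "0 \<le> limsup (\<lambda>n. ereal (density_upto n X))" .
  show "limsup (\<lambda>n. ereal (density_upto n X)) \<le> 1"
    by (intro Limsup_bounded always_eventually) (simp add: density_upto_le_1)
qed

lemma ereal_upper_density: "ereal (upper_density X) = limsup (\<lambda>n. ereal (density_upto n X))"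
  unfolding upper_density_def using limsup_density_bounds[of X]
  by (intro ereal_real') (auto simp: not_infty_ereal)

lemma upper_density_nonneg: "0 \<le> upper_density X"
  using limsup_density_bounds(1)[of X] by (simp flip: ereal_upper_density)

lemma upper_density_le_1: "upper_density X \<le> 1"
  using limsup_density_bounds(2)[of X] by (simp flip: ereal_upper_density)

lemma upper_density_Un_le:
  assumes "Z \<subseteq> X \<union> Y" shows "upper_density Z \<le> upper_density X + upper_density Y"
proof -
  have "ereal (upper_density Z) \<le> limsup (\<lambda>n. ereal (density_upto n X) + ereal (density_upto n Y))"
    unfolding ereal_upper_density
    by (intro Limsup_mono always_eventually) (simp add: density_upto_Un_le[OF assms])
  also have "\<dots> \<le> ereal (upper_density X) + ereal (upper_density Y)"
    unfolding ereal_upper_density by (rule ereal_limsup_add_mono)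
  finally show ?thesis by simp
qed

lemma coarse_similar_iff_upper_density: "coarse_similar X Y \<longleftrightarrow> upper_density (sym_diff X Y) = 0"
proof
  assume "coarse_similar X Y"
  then have "(\<lambda>n. ereal (density_upto n (sym_diff X Y))) \<longlonglongrightarrow> ereal 0"
    by (simp add: coarse_similar_def)
  then have "limsup (\<lambda>n. ereal (density_upto n (sym_diff X Y))) = ereal 0"
    by (intro lim_imp_Limsup) auto
  then show "upper_density (sym_diff X Y) = 0" by (simp add: upper_density_def)
next
  let ?f = "\<lambda>n. ereal (density_upto n (sym_diff X Y))"
  assume "upper_density (sym_diff X Y) = 0"
  then have "limsup ?f = 0" using ereal_upper_density by (metis zero_ereal_def)
  moreover have "0 \<le> liminf ?f"
    by (intro Liminf_bounded always_eventually) (simp add: density_upto_nonneg)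
  moreover have "liminf ?f \<le> limsup ?f" by (intro Liminf_le_Limsup) simp
  ultimately have "?f \<longlonglongrightarrow> 0" by (intro Liminf_eq_Limsup) auto
  then show "coarse_similar X Y" by (simp add: coarse_similar_def zero_ereal_def)
qed

lemma upper_density_sym_diff_triangle:
  "upper_density (sym_diff X Z) \<le> upper_density (sym_diff X Y) + upper_density (sym_diff Y Z)"
  by (rule upper_density_Un_le) auto

lemma equivp_coarse_similar: "equivp coarse_similar"
proof (rule equivpI)
  show "reflp coarse_similar"
    by (simp add: reflp_def coarse_similar_def density_upto_def)
  show "symp coarse_similar"
    by (simp add: symp_def coarse_similar_def Un_commute)
  show "transp coarse_similar"
  proof (rule transpI)
    fix X Y Z assume "coarse_similar X Y" "coarse_similar Y Z"
    then show "coarse_similar X Z"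
      unfolding coarse_similar_iff_upper_density
      using upper_density_sym_diff_triangle[of X Z Y] upper_density_nonneg[of "sym_diff X Z"] by linarith
  qed
qed

quotient_type coarse_class = "nat set" / coarse_similar morphisms rep_coarse_class coarse_class
  by (rule equivp_coarse_similar)

instantiation coarse_class :: metric_space
begin

lift_definition dist_coarse_class :: "coarse_class \<Rightarrow> coarse_class \<Rightarrow> real"
  is "\<lambda>X Y. upper_density (sym_diff X Y)"
proof -
  fix X X' Y Y' assume "coarse_similar X X'" "coarse_similar Y Y'"
  then have "upper_density (sym_diff X X') = 0" "upper_density (sym_diff Y Y') = 0"
    by (simp_all add: coarse_similar_iff_upper_density)
  then show "upper_density (sym_diff X Y) = upper_density (sym_diff X' Y')"
    using upper_density_sym_diff_triangle[of X Y X'] upper_density_sym_diff_triangle[of X' Y Y']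
      upper_density_sym_diff_triangle[of X' Y' X] upper_density_sym_diff_triangle[of X Y' Y]
    by (simp add: Un_commute)
qed

definition uniformity_coarse_class :: "(coarse_class \<times> coarse_class) filter" where
  "uniformity_coarse_class = (INF e\<in>{0<..}. principal {(x, y). dist x y < e})"

definition open_coarse_class :: "coarse_class set \<Rightarrow> bool" where
  "open_coarse_class U \<longleftrightarrow> (\<forall>x\<in>U. eventually (\<lambda>(x', y). x' = x \<longrightarrow> y \<in> U) uniformity)"

instance
proof
  fix x y z :: coarse_class
  show "dist x y = 0 \<longleftrightarrow> x = y"
    by transfer (simp add: coarse_similar_iff_upper_density)
  show "dist x y \<le> dist x z + dist y z"
    by transfer (metis upper_density_sym_diff_triangle Un_commute)
qed (simp_all add: uniformity_coarse_class_def open_coarse_class_def)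

end

lemma dist_coarse_class_le_1: "dist (x::coarse_class) y \<le> 1"
  by transfer (rule upper_density_le_1)

section \<open>The Hausdorff distance between degrees\<close>

text \<open>Meaningful for nonempty sets at bounded distance from each other; every set of
  coarse classes is bounded.\<close>

definition hausdorff_dist :: "'a::metric_space set \<Rightarrow> 'a set \<Rightarrow> real" where
  "hausdorff_dist A B = max (SUP x\<in>A. infdist x B) (SUP y\<in>B. infdist y A)"

definition coarse_below :: "tdegree \<Rightarrow> coarse_class set" where
  "coarse_below d = {coarse_class X |X. deg X \<le> d}"

definition degree_dist :: "tdegree \<Rightarrow> tdegree \<Rightarrow> real" where
  "degree_dist d e = hausdorff_dist (closure (coarse_below d)) (closure (coarse_below e))"

lemma coarse_below_nonempty: "coarse_below d \<noteq> {}"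
proof -
  have "deg (rep_tdegree d) \<le> d" by (simp add: Quotient3_abs_rep[OF Quotient3_tdegree])
  then show ?thesis unfolding coarse_below_def by blast
qed

section \<open>Comparability graphs and isometric embeddings\<close>

text \<open>A graph is a pair of a vertex set and an edge relation.\<close>

definition distance_one_graph :: "'a set \<Rightarrow> ('a \<Rightarrow> 'a \<Rightarrow> real) \<Rightarrow> 'a set \<times> ('a \<times> 'a) set" where
  "distance_one_graph M d = (M, {(x, y). x \<in> M \<and> y \<in> M \<and> d x y = 1})"

definition comparability_graph :: "'a set \<times> ('a \<times> 'a) set \<Rightarrow> bool" where
  "comparability_graph G \<longleftrightarrow>
    (\<exists>r. partial_order_on (fst G) r \<and>
      (\<forall>x\<in>fst G. \<forall>y\<in>fst G. (x, y) \<in> snd G \<longleftrightarrow> x \<noteq> y \<and> ((x, y) \<in> r \<or> (y, x) \<in> r)))"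

definition isometric_embedding ::
  "'a set \<Rightarrow> ('a \<Rightarrow> 'a \<Rightarrow> real) \<Rightarrow> 'b set \<Rightarrow> ('b \<Rightarrow> 'b \<Rightarrow> real) \<Rightarrow> ('a \<Rightarrow> 'b) \<Rightarrow> bool" where
  "isometric_embedding M d M' d' f \<longleftrightarrow>
    f ` M \<subseteq> M' \<and> (\<forall>x\<in>M. \<forall>y\<in>M. d' (f x) (f y) = d x y)"

end

(*
  Enumerate the points of M by natural numbers and let < be a partial order whose comparability
  graph is the given one. To each v attach a random set r_v (a column of fair coin tosses) and a
  set g_v, and let the oracle of x be the join of the g_v for v < x and the r_v for v incomparable
  to x. The set g_v may depend on the coins, but not on r_w for w > v.

  If x and y are incomparable, then r_x is computable from the oracle of y, while the oracle of x
  is independent of r_x. By the law of large numbers r_x is almost surely at distance exactly 1/2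
  from every set computable from the oracle of x, so the two degrees are at distance 1/2.

  If x < y, then g_x is computable from the oracle of y and has to be at distance 1 from every set
  computable from the oracle of x. The g_v are built together by finite extensions: given a program
  q, extend the g_v with v < x so as to nearly maximise the probability that q converges on a long
  interval, then let g_x be the complement of the computed values there. This fails only with small
  probability, so almost surely it succeeds on infinitely many intervals.
*)
theory Submission
  imports Defs "HOL-Probability.Probability"
begin

section \<open>The use of a computation\<close>

text \<open>The use principle without tracking oracle queries: the result is demanded of all oracles
  sharing the initial segment, which covers the case that queries depend on earlier answers.\<close>

definition secure :: "nat set \<Rightarrow> nat \<Rightarrow> prog \<Rightarrow> nat list \<Rightarrow> nat \<Rightarrow> bool" where
  "secure A k q xs y \<longleftrightarrow> (\<forall>B. B \<inter> {..<k} = A \<inter> {..<k} \<longrightarrow> evals B q xs y)"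

lemma secure_imp_evals: "secure A k q xs y \<Longrightarrow> B \<inter> {..<k} = A \<inter> {..<k} \<Longrightarrow> evals B q xs y"
  by (simp add: secure_def)

lemma secure_mono: "secure A j q xs y \<Longrightarrow> j \<le> k \<Longrightarrow> secure A k q xs y"
proof -
  assume j: "secure A j q xs y" "j \<le> k"
  have "evals B q xs y" if B: "B \<inter> {..<k} = A \<inter> {..<k}" for B
  proof -
    have "{..<k} \<inter> {..<j} = {..<j}" using j(2) by auto
    with B have "B \<inter> {..<j} = A \<inter> {..<j}" by (metis inf_assoc)
    with j(1) show ?thesis by (rule secure_imp_evals)
  qed
  then show "secure A k q xs y" by (simp add: secure_def)
qed

lemma secure_cong: "A \<inter> {..<k} = B \<inter> {..<k} \<Longrightarrow> secure A k q xs y \<longleftrightarrow> secure B k q xs y"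
  by (simp add: secure_def)

text \<open>Induction on the evaluation. The form with \<open>eventually\<close> lets the bounds of
  finitely many subcomputations combine without an explicit maximum.\<close>

lemma evals_imp_eventually_secure:
  "evals A q xs y \<Longrightarrow> eventually (\<lambda>k. secure A k q xs y) sequentially"
proof (induction rule: evals.induct)
  case (evals_Oracle x)
  have "eventually (\<lambda>k. x < k) sequentially"
    by (rule eventually_gt_at_top)
  then show ?case
  proof eventually_elim
    case (elim k)
    have "evals B Oracle [x] (of_bool (x \<in> A))" if "B \<inter> {..<k} = A \<inter> {..<k}" for B
    proof -
      have "x \<in> B \<longleftrightarrow> x \<in> A" using that elim by (metis IntI IntD1 lessThan_iff)
      then show ?thesis using evals.evals_Oracle[of B x] by simp
    qed
    then show ?case by (simp add: secure_def)
  qed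
next
  case (evals_Comp xs qs ys p z)
  have "eventually (\<lambda>k. \<forall>i\<in>{..<length qs}. secure A k (qs ! i) xs (ys ! i)) sequentially"
  proof (intro eventually_ball_finite ballI)
    fix i assume "i \<in> {..<length qs}"
    with list_all2_nthD[OF evals_Comp.IH(1), of i]
    show "eventually (\<lambda>k. secure A k (qs ! i) xs (ys ! i)) sequentially" by simp
  qed simp
  with evals_Comp.IH(2) show ?case
  proof eventually_elim
    case (elim k)
    have len: "length qs = length ys" using evals_Comp.IH(1) by (rule list_all2_lengthD)
    have "evals B (Comp p qs) xs z" if B: "B \<inter> {..<k} = A \<inter> {..<k}" for B
    proof (rule evals.evals_Comp)
      show "list_all2 (\<lambda>q y. evals B q xs y) qs ys"
      proof (rule list_all2_all_nthI[OF len])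
        fix i assume "i < length qs"
        with elim(2) have "secure A k (qs ! i) xs (ys ! i)" by simp
        then show "evals B (qs ! i) xs (ys ! i)" using B by (rule secure_imp_evals)
      qed
      show "evals B p ys z" using elim(1) B by (rule secure_imp_evals)
    qed
    then show ?case by (simp add: secure_def)
  qed
next
  case (evals_Prec_Suc p q n xs y z)
  from evals_Prec_Suc.IH show ?case
  proof eventually_elim
    case (elim k)
    then show ?case unfolding secure_def by (blast intro: evals.evals_Prec_Suc)
  qed
next
  case (evals_Mu p n xs)
  have "\<forall>m\<in>{..<n}. \<exists>v. eventually (\<lambda>k. secure A k p (m # xs) (Suc v)) sequentially"
  proof
    fix m assume "m \<in> {..<n}"
    then have "m < n" by simp
    with evals_Mu.IH(2) show "\<exists>v. eventually (\<lambda>k. secure A k p (m # xs) (Suc v)) sequentially"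
      by (elim allE[of _ m]) auto
  qed
  \<comment> \<open>Fixing the nonzero values \<open>v m\<close> first lets one bound serve all
    arguments below \<open>n\<close> at once.\<close>
  from bchoice[OF this] obtain v where
    "\<forall>m\<in>{..<n}. eventually (\<lambda>k. secure A k p (m # xs) (Suc (v m))) sequentially" ..
  then have "eventually (\<lambda>k. \<forall>m\<in>{..<n}. secure A k p (m # xs) (Suc (v m))) sequentially"
    by (intro eventually_ball_finite) simp_all
  with evals_Mu.IH(1) show ?case
  proof eventually_elim
    case (elim k)
    have "evals B (Mu p) xs n" if "B \<inter> {..<k} = A \<inter> {..<k}" for B
    proof (rule evals.evals_Mu)
      show "evals B p (n # xs) 0" using elim(1) that by (rule secure_imp_evals)
      show "\<forall>m<n. \<exists>k. evals B p (m # xs) (Suc k)"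
      proof (intro allI impI exI)
        fix m assume "m < n"
        with elim(2) have "secure A k p (m # xs) (Suc (v m))" by simp
        then show "evals B p (m # xs) (Suc (v m))" using that by (rule secure_imp_evals)
      qed
    qed
    then show ?case by (simp add: secure_def)
  qed
next
  case (evals_Prec_0 p xs y q)
  from evals_Prec_0.IH show ?case
    by eventually_elim (simp add: secure_def evals.evals_Prec_0)
next
  case (evals_Zero xs)
  show ?case by (simp add: secure_def evals.evals_Zero)
next
  case (evals_Succ x)
  show ?case by (simp add: secure_def evals.evals_Succ)
next
  case (evals_Proj i xs)
  then show ?case by (simp add: secure_def evals.evals_Proj)
qed

lemma evals_iff_secure: "evals A q xs y \<longleftrightarrow> (\<exists>k. secure A k q xs y)"
proof
  assume "evals A q xs y"
  from eventually_happens'[OF _ evals_imp_eventually_secure[OF this]]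
  show "\<exists>k. secure A k q xs y" by simp
next
  assume "\<exists>k. secure A k q xs y"
  then show "evals A q xs y" by (auto intro: secure_imp_evals)
qed

text \<open>Allows requirements to be enumerated and almost sure statements to be intersected over
  all programs.\<close>

instance prog :: countable
  by countable_datatype

section \<open>Columns of a set and their computability\<close>

definition column :: "nat \<Rightarrow> nat set \<Rightarrow> nat set" where
  "column v A = {i. prod_encode (v, i) \<in> A}"

primrec const_prog :: "nat \<Rightarrow> prog" where
  "const_prog 0 = Zero"
| "const_prog (Suc n) = Comp Succ [const_prog n]"

lemma evals_const_prog: "evals A (const_prog n) xs n"
proof (induction n)
  case (Suc n)
  show ?case
    unfolding const_prog.simps using Suc by (intro evals_Comp[where ys = "[n]"] evals_Succ) auto
qed (simp add: evals_Zero)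

definition add_prog :: prog where
  "add_prog = Prec (Proj 0) (Comp Succ [Proj 1])"

lemma evals_add_prog: "evals A add_prog [m, n] (m + n)"
proof (induction m)
  case 0
  show ?case
    unfolding add_prog_def using evals_Proj[of 0 "[n]"] by (auto intro: evals_Prec_0)
next
  case (Suc m)
  have "evals A (Comp Succ [Proj 1]) [m, m + n, n] (Suc (m + n))"
    using evals_Proj[of 1 "[m, m + n, n]" A]
    by (intro evals_Comp[where ys = "[m + n]"] evals_Succ) auto
  then show ?case using Suc unfolding add_prog_def by (auto intro: evals_Prec_Suc)
qed

text \<open>Primitive recursion along the recurrence \<open>prod_encode_Suc\<close>; in the step,
  \<open>Proj 0\<close> is the counter and \<open>Proj 1\<close> the previous value.\<close>

definition pair_prog :: "nat \<Rightarrow> prog" where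
  "pair_prog v = Prec (const_prog (prod_encode (v, 0)))
     (Comp add_prog [Comp add_prog [const_prog (Suc v), Proj 0], Proj 1])"

lemma prod_encode_Suc: "prod_encode (v, Suc i) = Suc v + i + prod_encode (v, i)"
  by (simp add: prod_encode_def)

lemma evals_pair_prog: "evals A (pair_prog v) [i] (prod_encode (v, i))"
proof (induction i)
  case 0
  show ?case unfolding pair_prog_def by (intro evals_Prec_0 evals_const_prog)
next
  case (Suc i)
  let ?xs = "[i, prod_encode (v, i)]"
  have "evals A (Comp add_prog [const_prog (Suc v), Proj 0]) ?xs (Suc v + i)"
    using evals_const_prog[of A "Suc v"] evals_Proj[of 0 ?xs A]
    by (intro evals_Comp[where ys = "[Suc v, i]"] evals_add_prog) (auto simp del: const_prog.simps)
  then have "evals A (Comp add_prog [Comp add_prog [const_prog (Suc v), Proj 0], Proj 1]) ?xs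
      (prod_encode (v, Suc i))"
    unfolding prod_encode_Suc using evals_Proj[of 1 ?xs A]
    by (intro evals_Comp[where ys = "[Suc v + i, prod_encode (v, i)]"] evals_add_prog) auto
  then show ?case using Suc unfolding pair_prog_def by (auto intro: evals_Prec_Suc)
qed

lemma column_turing_le: "column v A \<le>\<^sub>T A"
proof -
  have "evals A (Comp Oracle [pair_prog v]) [x] (of_bool (x \<in> column v A))" for x
    unfolding column_def mem_Collect_eq using evals_pair_prog
    by (intro evals_Comp[where ys = "[prod_encode (v, x)]"] evals_Oracle) auto
  then show ?thesis unfolding turing_le_def by blast
qed

section \<open>Measurability of convergence with a random oracle\<close>

lemma measurable_secure:
  assumes "\<And>n. Measurable.pred M (\<lambda>r. n \<in> D r)"
  shows "Measurable.pred M (\<lambda>r. secure (D r) k q xs y)"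
proof -
  \<comment> \<open>Only the oracle below \<open>k\<close> matters, so the event is a finite union
    over the possible initial segments \<open>F\<close>.\<close>
  have "secure (D r) k q xs y \<longleftrightarrow>
      (\<exists>F\<in>Pow {..<k}. secure F k q xs y \<and> (\<forall>n\<in>{..<k}. n \<in> D r \<longleftrightarrow> n \<in> F))" for r
  proof
    assume "secure (D r) k q xs y"
    then have "secure (D r \<inter> {..<k}) k q xs y" by (simp add: secure_def)
    then show "\<exists>F\<in>Pow {..<k}. secure F k q xs y \<and> (\<forall>n\<in>{..<k}. n \<in> D r \<longleftrightarrow> n \<in> F)"
      by (intro bexI[of _ "D r \<inter> {..<k}"]) auto
  next
    assume "\<exists>F\<in>Pow {..<k}. secure F k q xs y \<and> (\<forall>n\<in>{..<k}. n \<in> D r \<longleftrightarrow> n \<in> F)"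
    then obtain F where "F \<subseteq> {..<k}" "secure F k q xs y" "\<forall>n\<in>{..<k}. n \<in> D r \<longleftrightarrow> n \<in> F"
      by blast
    then show "secure (D r) k q xs y"
      using secure_cong[of F k "D r" q xs y] by auto
  qed
  moreover have "Measurable.pred M (\<lambda>r. \<exists>F\<in>Pow {..<k}. secure F k q xs y \<and>
      (\<forall>n\<in>{..<k}. n \<in> D r \<longleftrightarrow> n \<in> F))"
    using assms by measurable
  ultimately show ?thesis by simp
qed

lemma measurable_evals:
  assumes "\<And>n. Measurable.pred M (\<lambda>r. n \<in> D r)"
  shows "Measurable.pred M (\<lambda>r. evals (D r) q xs y)"
  unfolding evals_iff_secure using measurable_secure[OF assms] by measurable

section \<open>Coin tossing and the law of large numbers\<close>

abbreviation coin :: "bool measure" where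
  "coin \<equiv> measure_pmf (bernoulli_pmf (1 / 2))"

definition coins :: "(nat \<Rightarrow> bool) measure" where
  "coins = PiM UNIV (\<lambda>_. coin)"

lemma space_coins [simp]: "space coins = UNIV"
  by (simp add: coins_def space_PiM)

interpretation coins: prob_space coins
  unfolding coins_def by (intro prob_space_PiM prob_space_measure_pmf)

lemma measurable_coin [measurable]: "Measurable.pred coins (\<lambda>r. r n)"
proof -
  have "(\<lambda>r. r n) \<in> measurable coins coin"
    unfolding coins_def by (rule measurable_component_singleton) simp
  then show ?thesis by (simp add: measurable_def pred_def)
qed

section \<open>Invariance of the coin measure under flipping one coin\<close>

definition flip :: "nat \<Rightarrow> (nat \<Rightarrow> bool) \<Rightarrow> nat \<Rightarrow> bool" where
  "flip k r = r(k := \<not> r k)"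

lemma emeasure_coin_Not: "emeasure coin (Not -` A) = emeasure coin A"
proof -
  have "map_pmf Not (bernoulli_pmf (1 / 2)) = bernoulli_pmf (1 / 2)"
  proof (rule pmf_eqI)
    fix b
    show "pmf (map_pmf Not (bernoulli_pmf (1 / 2))) b = pmf (bernoulli_pmf (1 / 2)) b"
      using pmf_map_inj'[of Not "bernoulli_pmf (1 / 2)" "\<not> b"] by (cases b) (auto simp: inj_def)
  qed
  then show ?thesis
    by (metis emeasure_map_pmf)
qed

lemma measurable_flip [measurable]: "flip k \<in> measurable coins coins"
  unfolding coins_def
proof (rule measurable_PiM_single')
  fix i :: nat
  have "Measurable.pred coins (\<lambda>r. flip k r i)"
    by (cases "i = k") (auto simp: flip_def)
  then show "(\<lambda>r. flip k r i) \<in> PiM UNIV (\<lambda>_. coin) \<rightarrow>\<^sub>M coin"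
    by (simp add: coins_def measurable_def pred_def)
qed (simp add: space_PiM)

lemma distr_flip: "distr coins coins (flip k) = coins"
proof -
  interpret product_prob_space "\<lambda>_. coin" "UNIV :: nat set"
    by unfold_locales
  have "distr coins coins (flip k) = PiM UNIV (\<lambda>_. coin)"
  proof (rule PiM_eq)
    show "sets (distr coins coins (flip k)) = sets (PiM UNIV (\<lambda>_. coin))"
      by (simp add: coins_def)
    fix J :: "nat set" and F :: "nat \<Rightarrow> bool set"
    assume J: "finite J" "J \<subseteq> UNIV"
    let ?F = "F(k := Not -` F k)"
    have "emeasure (distr coins coins (flip k)) (prod_emb UNIV (\<lambda>_. coin) J (Pi\<^sub>E J F)) =
        emeasure coins (flip k -` prod_emb UNIV (\<lambda>_. coin) J (Pi\<^sub>E J F))"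
      using J sets_PiM_I[of J UNIV F "\<lambda>_. coin"]
      by (subst emeasure_distr) (auto simp flip: coins_def)
    \<comment> \<open>A flip turns a cylinder into the cylinder with factor \<open>k\<close>
      replaced by its preimage under negation, which has the same mass for a fair coin.\<close>
    also have "flip k -` prod_emb UNIV (\<lambda>_. coin) J (Pi\<^sub>E J F) =
        prod_emb UNIV (\<lambda>_. coin) J (Pi\<^sub>E J ?F)"
      by (auto simp: prod_emb_def flip_def space_PiM PiE_iff split: if_splits)
    also have "emeasure coins \<dots> = (\<Prod>j\<in>J. emeasure coin (?F j))"
      unfolding coins_def using J by (intro emeasure_PiM_emb) auto
    also have "\<dots> = (\<Prod>j\<in>J. emeasure coin (F j))"
      by (intro prod.cong) (auto simp: emeasure_coin_Not)
    finally show "emeasure (distr coins coins (flip k)) (prod_emb UNIV (\<lambda>_. coin) J (Pi\<^sub>E J F)) =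
        (\<Prod>j\<in>J. emeasure coin (F j))" .
  qed
  then show ?thesis by (simp add: coins_def)
qed

text \<open>Takes the place of independence in the moment computations: since the flip preserves the
  measure, the expectation equals its own negative.\<close>

lemma expectation_flip_odd:
  fixes f :: "(nat \<Rightarrow> bool) \<Rightarrow> real"
  assumes [measurable]: "f \<in> borel_measurable coins" and odd: "\<And>r. f (flip k r) = - f r"
  shows "coins.expectation f = 0"
proof -
  have "coins.expectation f = integral\<^sup>L (distr coins coins (flip k)) f"
    by (simp add: distr_flip)
  also have "\<dots> = coins.expectation (\<lambda>r. f (flip k r))"
    by (intro integral_distr) auto
  also have "\<dots> = - coins.expectation f"
    by (simp add: odd)
  finally show ?thesis by simp
qed

text \<open>Independence expressed by symmetry: each sign has a private coin that reverses it and
  leaves the others alone. The signs may also depend on further coins, as when a coin column is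
  compared with a set computed from the remaining coins.\<close>

locale independent_signs =
  fixes X :: "nat \<Rightarrow> (nat \<Rightarrow> bool) \<Rightarrow> real" and c :: "nat \<Rightarrow> nat"
  assumes measurable_X [measurable]: "\<And>m. X m \<in> borel_measurable coins"
    and X_sign: "\<And>m r. X m r = 1 \<or> X m r = - 1"
    and X_flip: "\<And>m r. X m (flip (c m) r) = - X m r"
    and X_flip_other: "\<And>m j r. j \<noteq> m \<Longrightarrow> X j (flip (c m) r) = X j r"
begin

definition S :: "nat \<Rightarrow> (nat \<Rightarrow> bool) \<Rightarrow> real" where
  "S n r = (\<Sum>m<n. X m r)"

lemma measurable_S [measurable]: "S n \<in> borel_measurable coins"
  unfolding S_def by measurable

lemma S_flip: "S n (flip (c n) r) = S n r"
  unfolding S_def by (intro sum.cong) (auto simp: X_flip_other)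

lemma abs_S_le: "\<bar>S n r\<bar> \<le> real n"
proof -
  have "\<bar>S n r\<bar> \<le> (\<Sum>m<n. \<bar>X m r\<bar>)" unfolding S_def by (rule sum_abs)
  also have "\<dots> = (\<Sum>m<n. 1)" 
  proof (intro sum.cong)
    fix m show "\<bar>X m r\<bar> = 1" using X_sign[of m r] by auto
  qed simp
  finally show ?thesis by simp
qed

lemma integrable_S_power [simp, intro]: "integrable coins (\<lambda>r. S n r ^ k)"
proof (rule coins.integrable_const_bound[where B = "real n ^ k"])
  show "AE r in coins. norm (S n r ^ k) \<le> real n ^ k"
    by (intro AE_I2) (simp add: power_abs power_mono abs_S_le)
qed measurable

lemma expectation_S_square: "coins.expectation (\<lambda>r. S n r ^ 2) = real n"
proof (induction n)
  case 0
  show ?case by (simp add: S_def)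
next
  case (Suc n)
  let ?f = "\<lambda>r. 2 * S n r * X n r"
  have sq: "X n r * X n r = 1" for r using X_sign[of n r] by auto
  have eq: "S (Suc n) r ^ 2 = S n r ^ 2 + 1 + ?f r" for r
    using sq[of r] by (simp add: S_def power2_eq_square algebra_simps)
  have f: "?f r = S (Suc n) r ^ 2 - (S n r ^ 2 + 1)" for r using eq[of r] by simp
  have int: "integrable coins ?f"
    unfolding f by (intro Bochner_Integration.integrable_diff Bochner_Integration.integrable_add) auto
  \<comment> \<open>\<open>S n\<close> involves only signs before \<open>n\<close>, which ignore
    coin \<open>c n\<close>; so the cross term is odd under that flip.\<close>
  have "coins.expectation ?f = 0"
    by (rule expectation_flip_odd[where k = "c n"]) (auto simp: S_flip X_flip)
  then show ?case
    unfolding eq using int Suc coins.prob_space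
    by (subst Bochner_Integration.integral_add, auto)+
qed

text \<open>Expanding \<open>(S + X) ^ 4\<close> with \<open>X\<^sup>2 = 1\<close>, the terms odd in \<open>X\<close> have expectation 0.\<close>

lemma expectation_S_fourth: "coins.expectation (\<lambda>r. S n r ^ 4) \<le> 3 * real n ^ 2"
proof (induction n)
  case 0
  show ?case by (simp add: S_def)
next
  case (Suc n)
  let ?f = "\<lambda>r. (4 * S n r ^ 3 + 4 * S n r) * X n r"
  have sq: "X n r * X n r = 1" for r using X_sign[of n r] by auto
  have eq: "S (Suc n) r ^ 4 = S n r ^ 4 + 6 * S n r ^ 2 + 1 + ?f r" for r
  proof -
    have *: "(s + x) ^ 4 = s ^ 4 + 6 * s ^ 2 + 1 + (4 * s ^ 3 + 4 * s) * x"
      if "x = 1 \<or> x = -1" for s x :: real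
      using that by (auto simp: power4_eq_xxxx power3_eq_cube power2_eq_square algebra_simps)
    have "S (Suc n) r = S n r + X n r" by (simp add: S_def)
    then show ?thesis using *[OF X_sign[of n r], of "S n r"] by simp
  qed
  have f: "?f r = S (Suc n) r ^ 4 - (S n r ^ 4 + 6 * S n r ^ 2 + 1)" for r using eq[of r] by simp
  have int: "integrable coins ?f"
    unfolding f by (intro Bochner_Integration.integrable_diff Bochner_Integration.integrable_add) auto
  have "coins.expectation ?f = 0"
    by (rule expectation_flip_odd[where k = "c n"]) (auto simp: S_flip X_flip)
  then have "coins.expectation (\<lambda>r. S (Suc n) r ^ 4) =
      coins.expectation (\<lambda>r. S n r ^ 4) + 6 * real n + 1"
    unfolding eq using int coins.prob_space expectation_S_square[of n]
    by (subst Bochner_Integration.integral_add, auto)+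
  also have "\<dots> \<le> 3 * real (Suc n) ^ 2"
    using Suc by (simp add: power2_eq_square algebra_simps)
  finally show ?case .
qed

text \<open>The fourth moment of \<open>S n / n\<close> is at most 3 / n^2, which is summable. Hence
  the series of fourth powers converges almost surely and its terms tend to 0.\<close>

lemma law_of_large_numbers: "AE r in coins. (\<lambda>n. S n r / real n) \<longlonglongrightarrow> 0"
proof -
  let ?g = "\<lambda>n r. (S (Suc n) r / real (Suc n)) ^ 4"
  have int: "integrable coins (?g n)" for n
    by (simp add: power_divide)
  have le: "(\<integral>\<^sup>+ r. ennreal (?g n r) \<partial>coins) \<le> ennreal (3 / real (Suc n) ^ 2)" for n
  proof -
    have "(\<integral>\<^sup>+ r. ennreal (?g n r) \<partial>coins) = ennreal (coins.expectation (?g n))"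
      using int by (intro nn_integral_eq_integral) auto
    also have "coins.expectation (?g n) =
        coins.expectation (\<lambda>r. S (Suc n) r ^ 4) / real (Suc n) ^ 4"
      by (simp add: power_divide)
    also have "\<dots> \<le> 3 * real (Suc n) ^ 2 / real (Suc n) ^ 4"
      by (intro divide_right_mono expectation_S_fourth) auto
    also have "\<dots> = 3 / real (Suc n) ^ 2"
      by (simp add: power4_eq_xxxx power2_eq_square del: of_nat_Suc)
    finally show ?thesis by (simp add: ennreal_leI)
  qed
  have sum: "summable (\<lambda>n. 3 / real (Suc n) ^ 2)"
    using summable_mult[of "\<lambda>n. inverse (real (Suc n) ^ 2)" 3] inverse_power_summable[of 2, where 'a = real]
      summable_Suc_iff[of "\<lambda>n. 3 * inverse (real n ^ 2)"]
    by (simp add: divide_inverse del: of_nat_Suc)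
  have "(\<integral>\<^sup>+ r. (\<Sum>n. ennreal (?g n r)) \<partial>coins) = (\<Sum>n. \<integral>\<^sup>+ r. ennreal (?g n r) \<partial>coins)"
    by (intro nn_integral_suminf) measurable
  also have "\<dots> \<le> (\<Sum>n. ennreal (3 / real (Suc n) ^ 2))"
    by (intro suminf_le le) auto
  also have "\<dots> = ennreal (\<Sum>n. 3 / real (Suc n) ^ 2)"
    by (intro suminf_ennreal2 sum) auto
  also have "\<dots> < \<infinity>" by simp
  finally have "AE r in coins. (\<Sum>n. ennreal (?g n r)) \<noteq> \<infinity>"
    by (intro nn_integral_PInf_AE) auto
  then show ?thesis
  proof eventually_elim
    case (elim r)
    then have "summable (\<lambda>n. ?g n r)"
      by (intro summable_suminf_not_top) auto
    then have "(\<lambda>n. root 4 (?g n r)) \<longlonglongrightarrow> root 4 0"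
      by (intro tendsto_real_root summable_LIMSEQ_zero)
    moreover have "root 4 (x ^ 4) = \<bar>x\<bar>" for x :: real
      using real_root_power_cancel[of 4 "\<bar>x\<bar>"] by (simp add: power_even_abs_numeral)
    ultimately have "(\<lambda>n. \<bar>S (Suc n) r / real (Suc n)\<bar>) \<longlonglongrightarrow> 0"
      by simp
    then have "(\<lambda>n. S (Suc n) r / real (Suc n)) \<longlonglongrightarrow> 0"
      by (rule tendsto_rabs_zero_cancel)
    then show ?case
      by (rule filterlim_sequentially_Suc[THEN iffD1])
  qed
qed

end

lemma upper_density_eq_limit:
  assumes "(\<lambda>n. density_upto n X) \<longlonglongrightarrow> l" shows "upper_density X = l"
proof -
  have "limsup (\<lambda>n. ereal (density_upto n X)) = ereal l"
    using assms by (intro lim_imp_Limsup) auto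
  then show ?thesis by (simp add: upper_density_def)
qed

text \<open>Score 1 for agreement and -1 for disagreement of the coins with \<open>D r\<close>.
  Flipping coin \<open>c m\<close> leaves \<open>D r\<close> fixed and so reverses only score
  \<open>m\<close>; the average score tends to 0, which makes disagreement have density 1/2.\<close>

lemma AE_upper_density_half:
  fixes D :: "(nat \<Rightarrow> bool) \<Rightarrow> nat set"
  assumes c: "inj c" and meas: "\<And>m. Measurable.pred coins (\<lambda>r. m \<in> D r)"
    and inv: "\<And>m r. D (flip (c m) r) = D r"
  shows "AE r in coins. upper_density (sym_diff {m. r (c m)} (D r)) = 1 / 2"
proof -
  define X :: "nat \<Rightarrow> (nat \<Rightarrow> bool) \<Rightarrow> real" where
    "X m r = (if r (c m) = (m \<in> D r) then 1 else - 1)" for m r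
  interpret independent_signs X c
  proof
    show "X m \<in> borel_measurable coins" for m
      unfolding X_def using meas[measurable] by measurable
    show "X m r = 1 \<or> X m r = - 1" for m r by (simp add: X_def)
    show "X m (flip (c m) r) = - X m r" for m r
      by (auto simp: X_def inv) (auto simp: flip_def)
    show "X j (flip (c m) r) = X j r" if "j \<noteq> m" for m j r
    proof -
      have "c j \<noteq> c m" using that injD[OF c, of j m] by auto
      then have "flip (c m) r (c j) = r (c j)" by (simp add: flip_def)
      then show ?thesis by (simp add: X_def inv)
    qed
  qed
  show ?thesis using law_of_large_numbers
  proof eventually_elim
    case (elim r)
    let ?E = "sym_diff {m. r (c m)} (D r)"
    have S: "S n r = real n - 2 * real (card (?E \<inter> {0..<n}))" for n
    proof -
      have "S n r = (\<Sum>m\<in>{0..<n}. 1 - 2 * of_bool (m \<in> ?E))"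
        unfolding S_def lessThan_atLeast0 by (intro sum.cong) (auto simp: X_def)
      also have "\<dots> = real n - 2 * (\<Sum>m\<in>{0..<n}. of_bool (m \<in> ?E))"
        by (simp add: sum_subtractf sum_distrib_left)
      also have "(\<Sum>m\<in>{0..<n}. of_bool (m \<in> ?E) :: real) = real (card (?E \<inter> {0..<n}))"
        by (subst sum_of_bool_eq) (auto simp: Int_commute Int_def)
      finally show ?thesis .
    qed
    have "(\<lambda>n. (1 - S n r / real n) / 2) \<longlonglongrightarrow> (1 - 0) / 2"
      by (intro tendsto_intros elim) auto
    moreover have "eventually (\<lambda>n. (1 - S n r / real n) / 2 = density_upto n ?E) sequentially"
      using eventually_gt_at_top[of 0]
      by eventually_elim (simp add: S density_upto_def field_simps)
    ultimately have "(\<lambda>n. density_upto n ?E) \<longlonglongrightarrow> (1 - 0) / 2"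
      by (rule Lim_transform_eventually)
    then show ?case using upper_density_eq_limit by simp
  qed
qed

section \<open>Oracles for a countable partial order\<close>

locale strict_order =
  fixes lt :: "nat \<Rightarrow> nat \<Rightarrow> bool"
  assumes lt_irrefl: "\<not> lt x x" and lt_trans: "lt x y \<Longrightarrow> lt y z \<Longrightarrow> lt x z"
begin

definition inc :: "nat \<Rightarrow> nat \<Rightarrow> bool" where
  "inc x y \<longleftrightarrow> x \<noteq> y \<and> \<not> lt x y \<and> \<not> lt y x"

abbreviation idx :: "nat \<Rightarrow> nat" where
  "idx n \<equiv> fst (prod_decode n)"

text \<open>Every column keeps its place, so it can be read off by \<open>column\<close>. Column
  \<open>x\<close> and the columns above \<open>x\<close> stay empty.\<close>

definition join :: "(nat \<Rightarrow> (nat \<Rightarrow> bool) \<Rightarrow> bool) \<Rightarrow> nat \<Rightarrow> (nat \<Rightarrow> bool) \<Rightarrow> nat set" where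
  "join G x r = {n. lt (idx n) x \<and> G n r \<or> inc (idx n) x \<and> r n}"

text \<open>The bits of column \<open>v\<close> may depend on every coin column except those above \<open>v\<close>. Hence
  \<open>join G w\<close>, which sees column \<open>v\<close> only for \<open>v < w\<close>, is independent of coin column \<open>w\<close>.\<close>

definition legal :: "(nat \<Rightarrow> (nat \<Rightarrow> bool) \<Rightarrow> bool) \<Rightarrow> bool" where
  "legal G \<longleftrightarrow> (\<forall>n. Measurable.pred coins (G n) \<and>
     (\<forall>r r'. (\<forall>m. \<not> lt (idx n) (idx m) \<longrightarrow> r m = r' m) \<longrightarrow> G n r = G n r'))"

lemma legal_measurable: "legal G \<Longrightarrow> Measurable.pred coins (G n)"
  by (simp add: legal_def)

lemma legal_cong: "legal G \<Longrightarrow> (\<And>m. \<not> lt (idx n) (idx m) \<Longrightarrow> r m = r' m) \<Longrightarrow> G n r = G n r'"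
  unfolding legal_def by blast

lemma measurable_join:
  assumes "legal G" shows "Measurable.pred coins (\<lambda>r. n \<in> join G x r)"
proof -
  note [measurable] = legal_measurable[OF assms]
  show ?thesis unfolding join_def mem_Collect_eq by measurable
qed

text \<open>If v < x, then by transitivity \<open>x\<close> and everything above it lie above v, so
  a legal column v cannot see those coins. The coins that enter the join directly lie in columns
  incomparable to \<open>x\<close>.\<close>

lemma join_cong:
  assumes "legal G" and "\<And>m. idx m \<noteq> x \<Longrightarrow> \<not> lt x (idx m) \<Longrightarrow> r m = r' m"
  shows "join G x r = join G x r'"
proof -
  have "G n r = G n r'" if "lt (idx n) x" for n
  proof (rule legal_cong[OF assms(1)])
    fix m assume "\<not> lt (idx n) (idx m)"
    with that show "r m = r' m" by (intro assms(2)) (auto dest: lt_trans)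
  qed
  moreover have "r n = r' n" if "inc (idx n) x" for n
    using that by (intro assms(2)) (auto simp: inc_def)
  ultimately show ?thesis by (auto simp: join_def)
qed

lemma join_cong_generic: "(\<And>n. lt (idx n) x \<Longrightarrow> G n = H n) \<Longrightarrow> join G x r = join H x r"
  by (auto simp: join_def)

lemma join_initial: "(\<And>n. n < k \<Longrightarrow> G n = H n) \<Longrightarrow> join G x r \<inter> {..<k} = join H x r \<inter> {..<k}"
  by (auto simp: join_def)

text \<open>The bad event for one interval: outside it, if \<open>q\<close> computes a set from the
  oracle of \<open>x\<close>, then column \<open>x\<close> is the exact complement of that set on
  \<open>{a..<b}\<close>. It is later covered by a measurable set rather than measured
  itself.\<close>

definition fails :: "(nat \<Rightarrow> (nat \<Rightarrow> bool) \<Rightarrow> bool) \<Rightarrow> nat \<Rightarrow> prog \<Rightarrow> nat \<Rightarrow> nat \<Rightarrow> (nat \<Rightarrow> bool) set" where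
  "fails G x q a b = {r. \<exists>B. (\<forall>m\<in>{a..<b}. evals (join G x r) q [m] (of_bool (m \<in> B))) \<and>
     (\<exists>m\<in>{a..<b}. G (prod_encode (x, m)) r = (m \<in> B))}"

text \<open>The extension \<open>H\<close> of the first \<open>k\<close> positions of \<open>G\<close> nearly maximises the probability that
  \<open>q\<close> converges on \<open>{k..<b}\<close>. Once that happens with use below \<open>k'\<close>, no further extension can
  produce convergence on more than a small set of coin sequences, and column \<open>x\<close>, which
  \<open>join H x\<close> does not see, can be made to disagree with the computed values.\<close>

lemma diagonal_extension:
  assumes G: "legal G" and e: "e > 0"
  shows "\<exists>H k'. legal H \<and> k < k' \<and> (\<forall>n<k. H n = G n) \<and>
    (\<forall>K. legal K \<longrightarrow> (\<forall>n<k'. K n = H n) \<longrightarrow>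
      (\<exists>N\<in>sets coins. fails K x q k b \<subseteq> N \<and> measure coins N < e))"
proof -
  let ?ext = "\<lambda>H. legal H \<and> (\<forall>n<k. H n = G n)"
  define V where "V H = {r. \<forall>m\<in>{k..<b}. \<exists>y. evals (join H x r) q [m] y}" for H
  define W where "W j H = {r. \<forall>m\<in>{k..<b}. \<exists>y. secure (join H x r) j q [m] y}" for j H
  have V_sets: "V H \<in> sets coins" if "legal H" for H
  proof -
    note [measurable] = measurable_evals[OF measurable_join[OF that]]
    have "Measurable.pred coins (\<lambda>r. \<forall>m\<in>{k..<b}. \<exists>y. evals (join H x r) q [m] y)" by measurable
    then show ?thesis by (simp add: V_def pred_def)
  qed
  have W_sets: "W j H \<in> sets coins" if "legal H" for j H
  proof -
    note [measurable] = measurable_secure[OF measurable_join[OF that]]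
    have "Measurable.pred coins (\<lambda>r. \<forall>m\<in>{k..<b}. \<exists>y. secure (join H x r) j q [m] y)" by measurable
    then show ?thesis by (simp add: W_def pred_def)
  qed
  define \<beta> where "\<beta> = (SUP H\<in>Collect ?ext. measure coins (V H))"
  have bdd: "bdd_above ((\<lambda>H. measure coins (V H)) ` Collect ?ext)"
    by (intro bdd_aboveI[of _ 1]) auto
  \<comment> \<open>The supremum may not be attained. Half of \<open>e\<close> is spent here, the
    other half on bounding the use by \<open>j\<close>.\<close>
  have "\<exists>H\<in>Collect ?ext. \<beta> - e / 2 < measure coins (V H)"
    using less_cSUP_iff[OF _ bdd, of "\<beta> - e / 2"] G e unfolding \<beta>_def by auto
  then obtain H where H: "legal H" "\<forall>n<k. H n = G n" "\<beta> - e / 2 < measure coins (V H)"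
    by auto
  have "V H = (\<Union>j. W j H)"
  proof (intro set_eqI iffI)
    fix r assume "r \<in> V H"
    have "\<forall>m\<in>{k..<b}. eventually (\<lambda>j. \<exists>y. secure (join H x r) j q [m] y) sequentially"
    proof
      fix m assume "m \<in> {k..<b}"
      with \<open>r \<in> V H\<close> have "\<exists>y. evals (join H x r) q [m] y" by (simp add: V_def)
      then obtain y where "evals (join H x r) q [m] y" ..
      from evals_imp_eventually_secure[OF this]
      show "eventually (\<lambda>j. \<exists>y. secure (join H x r) j q [m] y) sequentially"
        by (rule eventually_mono) blast
    qed
    then have "eventually (\<lambda>j. \<forall>m\<in>{k..<b}. \<exists>y. secure (join H x r) j q [m] y) sequentially"
      by (intro eventually_ball_finite) auto
    from eventually_happens'[OF _ this] show "r \<in> (\<Union>j. W j H)" by (auto simp: W_def)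
  next
    fix r assume "r \<in> (\<Union>j. W j H)"
    then show "r \<in> V H" unfolding V_def W_def using evals_iff_secure by blast
  qed
  moreover have "incseq (\<lambda>j. W j H)"
    unfolding incseq_def W_def using secure_mono by blast
  ultimately have "(\<lambda>j. measure coins (W j H)) \<longlonglongrightarrow> measure coins (V H)"
    using coins.finite_Lim_measure_incseq[of "\<lambda>j. W j H"] W_sets[OF H(1)] by auto
  then have "eventually (\<lambda>j. measure coins (V H) - e / 2 < measure coins (W j H)) sequentially"
    using e by (intro order_tendstoD(1)) auto
  then obtain j where j: "measure coins (V H) - e / 2 < measure coins (W j H)"
    by (auto dest: eventually_happens'[rotated])
  \<comment> \<open>On the interval, column \<open>x\<close> negates the computed bits. The oracle
    comes from \<open>H\<close>, which avoids circularity; since \<open>x\<close> is not below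
    itself, \<open>H'\<close> yields the same oracle.\<close>
  define H' where "H' n = (if idx n = x \<and> snd (prod_decode n) \<in> {k..<b}
    then (\<lambda>r. \<not> evals (join H x r) q [snd (prod_decode n)] 1) else H n)" for n
  have H': "legal H'"
    unfolding legal_def
  proof (intro allI conjI impI)
    fix n
    note [measurable] = measurable_evals[OF measurable_join[OF H(1)]] legal_measurable[OF H(1)]
    show "Measurable.pred coins (H' n)" unfolding H'_def by simp
    fix r r' :: "nat \<Rightarrow> bool" assume eq: "\<forall>m. \<not> lt (idx n) (idx m) \<longrightarrow> r m = r' m"
    show "H' n r = H' n r'"
    proof (cases "idx n = x")
      case True
      then have "join H x r = join H x r'" using eq by (intro join_cong H(1)) auto
      then show ?thesis using legal_cong[OF H(1), of n r r'] eq by (auto simp: H'_def)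
    next
      case False
      then show ?thesis using legal_cong[OF H(1), of n r r'] eq by (auto simp: H'_def)
    qed
  qed
  have H'G: "H' n = G n" if "n < k" for n
  proof -
    \<comment> \<open>A changed position codes a pair with second entry at least \<open>k\<close>,
      hence is itself at least \<open>k\<close>.\<close>
    have "snd (prod_decode n) \<le> n"
      by (metis le_prod_encode_2 prod.collapse prod_decode_inverse)
    with that H(2) show ?thesis by (auto simp: H'_def)
  qed
  have DH': "join H' x r = join H x r" for r
    by (rule join_cong_generic) (auto simp: H'_def lt_irrefl)
  \<comment> \<open>Large enough to grow strictly, to freeze the oracle up to the use bound
    \<open>j\<close>, and to freeze the new bits of column \<open>x\<close>.\<close>
  define k' where "k' = Max (insert (Suc k) (insert j ((\<lambda>m. Suc (prod_encode (x, m))) ` {k..<b})))"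
  have k': "k < k'" "j \<le> k'" "\<And>m. m \<in> {k..<b} \<Longrightarrow> prod_encode (x, m) < k'"
  proof -
    have *: "z \<le> k'" if "z \<in> insert (Suc k) (insert j ((\<lambda>m. Suc (prod_encode (x, m))) ` {k..<b}))" for z
      unfolding k'_def using that by (intro Max_ge) auto
    show "k < k'" "j \<le> k'" using *[of "Suc k"] *[of j] by auto
    show "prod_encode (x, m) < k'" if "m \<in> {k..<b}" for m
      using *[of "Suc (prod_encode (x, m))"] that by auto
  qed
  have "\<exists>N\<in>sets coins. fails K x q k b \<subseteq> N \<and> measure coins N < e"
    if K: "legal K" "\<forall>n<k'. K n = H' n" for K
  proof (intro bexI conjI)
    have DK: "join K x r \<inter> {..<j} = join H x r \<inter> {..<j}" for r
      unfolding DH'[symmetric] using K(2) k'(2) by (intro join_initial) auto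
    \<comment> \<open>\<open>K\<close> competes in the supremum, so \<open>V K\<close> has measure
      at most \<beta>, while its subset \<open>W j H\<close> already has measure above \<beta> -
      e.\<close>
    have "?ext K" using K H'G k'(1) by auto
    then have VK: "measure coins (V K) \<le> \<beta>"
      unfolding \<beta>_def by (intro cSUP_upper bdd) auto
    have sub: "W j H \<subseteq> V K"
    proof
      fix r assume "r \<in> W j H"
      then show "r \<in> V K" unfolding W_def V_def using secure_imp_evals[OF _ DK] by blast
    qed
    show "V K - W j H \<in> sets coins" using V_sets[OF K(1)] W_sets[OF H(1)] by auto
    have "measure coins (V K - W j H) = measure coins (V K) - measure coins (W j H)"
      using sub V_sets[OF K(1)] W_sets[OF H(1)] by (intro coins.finite_measure_Diff) auto
    also have "\<dots> < e" using VK H(3) j by simp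
    finally show "measure coins (V K - W j H) < e" .
    show "fails K x q k b \<subseteq> V K - W j H"
    proof
      fix r assume "r \<in> fails K x q k b"
      then obtain B m where B: "\<forall>m\<in>{k..<b}. evals (join K x r) q [m] (of_bool (m \<in> B))"
        and m: "m \<in> {k..<b}" "K (prod_encode (x, m)) r = (m \<in> B)"
        unfolding fails_def by blast
      have "r \<in> V K" using B unfolding V_def by blast
      \<comment> \<open>On \<open>W j H\<close> the computed values are frozen, and \<open>K\<close>
        keeps the bits of \<open>H'\<close> that negate them.\<close>
      moreover have "r \<notin> W j H"
      proof
        assume "r \<in> W j H"
        with m(1) obtain y where y: "secure (join H x r) j q [m] y" unfolding W_def by blast
        have "evals (join K x r) q [m] y" using y DK by (rule secure_imp_evals)
        with B m(1) have "y = of_bool (m \<in> B)" using evals_deterministic by blast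
        moreover have "evals (join H x r) q [m] y" using y by (rule secure_imp_evals) simp
        ultimately have "evals (join H x r) q [m] 1 \<longleftrightarrow> m \<in> B"
          using evals_deterministic[of "join H x r" q "[m]" y 1] by (cases "m \<in> B") auto
        moreover have "K (prod_encode (x, m)) = H' (prod_encode (x, m))"
          using K(2) k'(3)[OF m(1)] by blast
        ultimately show False using m by (simp add: H'_def)
      qed
      ultimately show "r \<in> V K - W j H" by blast
    qed
  qed
  then show ?thesis using H' H'G k'(1) by blast
qed

end

lemma upper_density_geI:
  assumes "\<And>N. \<exists>n\<ge>N. c \<le> density_upto n X" shows "c \<le> upper_density X"
proof (rule ccontr)
  assume "\<not> c \<le> upper_density X"
  then have "limsup (\<lambda>n. ereal (density_upto n X)) < ereal c"
    by (simp flip: ereal_upper_density)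
  then have "eventually (\<lambda>n. density_upto n X < c) sequentially"
    using Limsup_lessD by fastforce
  then show False
    using assms unfolding eventually_sequentially by (meson linorder_not_le)
qed

section \<open>The limit of the construction and almost sure diagonalization\<close>

context strict_order
begin

text \<open>The part of the initial segment before \<open>a\<close> is then less than a fraction 1 /
  (n + 1) of the whole, also for a = 0.\<close>

abbreviation stage_end :: "nat \<Rightarrow> nat \<Rightarrow> nat" where
  "stage_end n a \<equiv> Suc n * Suc a"

text \<open>Stage \<open>j\<close> treats the requirement (x, q, n) coded by \<open>j\<close>, on an
  interval starting at the length frozen so far. The limit extends every stage, so the guarantee of
  each stage applies to it.\<close>

lemma ex_diagonal:
  "\<exists>G. legal G \<and> (\<forall>x q n. \<exists>a. \<exists>N\<in>sets coins.
     fails G x q a (stage_end n a) \<subseteq> N \<and> measure coins N < (1 / 2) ^ n)"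
proof -
  define good where "good j k K \<longleftrightarrow> (\<forall>x q n. from_nat j = (x, q, n) \<longrightarrow>
    (\<exists>N\<in>sets coins. fails K x q k (stage_end n k) \<subseteq> N \<and> measure coins N < (1 / 2) ^ n))" for j k K
  define extends where "extends s t \<longleftrightarrow> snd s < snd t \<and> (\<forall>i<snd s. fst t i = fst s i)"
    for s t :: "(nat \<Rightarrow> (nat \<Rightarrow> bool) \<Rightarrow> bool) \<times> nat"
  \<comment> \<open>All legal continuations are covered because the limit is not yet known.\<close>
  define forces where "forces j k t \<longleftrightarrow>
    (\<forall>K. legal K \<longrightarrow> (\<forall>i<snd t. K i = fst t i) \<longrightarrow> good j k K)"
    for j k and t :: "(nat \<Rightarrow> (nat \<Rightarrow> bool) \<Rightarrow> bool) \<times> nat"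
  have "\<exists>s. \<forall>j. legal (fst (s j)) \<and> extends (s j) (s (Suc j)) \<and> forces j (snd (s j)) (s (Suc j))"
  proof (rule dependent_nat_choice)
    have "legal (\<lambda>_ _. False)" by (simp add: legal_def)
    then show "\<exists>s :: (nat \<Rightarrow> (nat \<Rightarrow> bool) \<Rightarrow> bool) \<times> nat. legal (fst s)"
      by (intro exI[of _ "(\<lambda>_ _. False, 0)"]) simp
    fix s :: "(nat \<Rightarrow> (nat \<Rightarrow> bool) \<Rightarrow> bool) \<times> nat" and j :: nat
    assume legal: "legal (fst s)"
    obtain x q n where j: "from_nat j = (x :: nat, q :: prog, n :: nat)"
      by (rule prod_cases3)
    have "0 < (1 / 2 :: real) ^ n" by simp
    from diagonal_extension[OF legal this, of "snd s" x q "stage_end n (snd s)"]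
    obtain H k where H: "legal H" "snd s < k" "\<forall>i<snd s. H i = fst s i"
      and K: "\<forall>K. legal K \<longrightarrow> (\<forall>i<k. K i = H i) \<longrightarrow>
        (\<exists>N\<in>sets coins. fails K x q (snd s) (stage_end n (snd s)) \<subseteq> N \<and> measure coins N < (1 / 2) ^ n)"
      by (elim exE conjE)
    have "extends s (H, k)" using H by (simp add: extends_def)
    moreover have "forces j (snd s) (H, k)"
      unfolding forces_def good_def j using K by (simp del: mult_Suc mult_Suc_right)
    ultimately show "\<exists>t. legal (fst t) \<and> extends s t \<and> forces j (snd s) t"
      using H(1) by (intro exI[of _ "(H, k)"]) simp
  qed
  then obtain s where s: "\<forall>j. legal (fst (s j)) \<and> extends (s j) (s (Suc j)) \<and>
    forces j (snd (s j)) (s (Suc j))" ..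
  have legal: "legal (fst (s j))" for j
    using s by blast
  have mono: "snd (s j) < snd (s (Suc j))" for j
    using s by (simp add: extends_def)
  have agree: "fst (s (Suc j)) i = fst (s j) i" if "i < snd (s j)" for i j
    using s that by (simp add: extends_def)
  have good: "good j (snd (s j)) K"
    if "legal K" "\<And>i. i < snd (s (Suc j)) \<Longrightarrow> K i = fst (s (Suc j)) i" for j K
    using s that by (simp add: forces_def)
  have sm: "strict_mono (\<lambda>j. snd (s j))"
    using mono by (simp add: strict_mono_Suc_iff)
  have agree': "fst (s l) i = fst (s j) i" if "j \<le> l" "i < snd (s j)" for j l i
    using that(1)
  proof (induction l rule: dec_induct)
    case (step l)
    have "snd (s j) \<le> snd (s l)" 
      using strict_mono_less_eq[OF sm, of j l] step.hyps(1) by simp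
    with step that(2) show ?case by (simp add: agree)
  qed simp
  \<comment> \<open>Stage \<open>Suc i\<close> has frozen at least \<open>Suc i\<close> positions,
    so position \<open>i\<close> is final there.\<close>
  define G where "G i = fst (s (Suc i)) i" for i
  have G: "G i = fst (s j) i" if "i < snd (s j)" for i j
  proof (cases "j \<le> Suc i")
    case True
    then show ?thesis using agree'[OF True that] by (simp add: G_def)
  next
    case False
    have "i < snd (s (Suc i))" using strict_mono_imp_increasing[OF sm, of "Suc i"] by simp
    then show ?thesis using agree'[of "Suc i" j i] False by (simp add: G_def)
  qed
  \<comment> \<open>Legality constrains each bit separately and so passes to the limit.\<close>
  have "legal G"
    using legal unfolding legal_def G_def by blast
  moreover have "\<exists>a. \<exists>N\<in>sets coins. fails G x q a (stage_end n a) \<subseteq> N \<and> measure coins N < (1 / 2) ^ n"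
    for x q n
    using good[OF \<open>legal G\<close> G, of "to_nat (x, q, n)"]
    unfolding good_def by (intro exI[of _ "snd (s (to_nat (x, q, n)))"]) (simp del: mult_Suc mult_Suc_right)
  ultimately show ?thesis by blast
qed

text \<open>Failure at all n \<ge> i places \<open>r\<close> in every such \<open>N n\<close>; these
  sets have arbitrarily small measure, so their intersection is null.\<close>

lemma AE_infinitely_often_not_fails:
  assumes "\<And>n. \<exists>N\<in>sets coins. fails G x q (a n) (b n) \<subseteq> N \<and> measure coins N < (1 / 2) ^ n"
  shows "AE r in coins. \<forall>i. \<exists>n\<ge>i. r \<notin> fails G x q (a n) (b n)"
  unfolding AE_all_countable
proof
  fix i
  obtain N where N: "\<And>n. N n \<in> sets coins" "\<And>n. fails G x q (a n) (b n) \<subseteq> N n"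
    "\<And>n. measure coins (N n) < (1 / 2) ^ n"
    using assms by metis
  let ?N = "\<Inter>n\<in>{i..}. N n"
  have sets: "?N \<in> sets coins" using N(1) by (intro sets.countable_INT') auto
  have "measure coins ?N \<le> (1 / 2) ^ n" if "i \<le> n" for n
  proof -
    have "measure coins ?N \<le> measure coins (N n)"
      using that N(1) by (intro coins.finite_measure_mono) auto
    with N(3)[of n] show ?thesis by simp
  qed
  then have "measure coins ?N \<le> 0"
    by (intro LIMSEQ_le_const[OF LIMSEQ_realpow_zero[of "1 / 2"]]) auto
  then have "measure coins ?N = 0" by (simp add: measure_le_0_iff)
  then have "?N \<in> null_sets coins"
    using sets by (simp add: coins.emeasure_eq_measure null_setsI)
  then show "AE r in coins. \<exists>n\<ge>i. r \<notin> fails G x q (a n) (b n)"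
    by (rule AE_I') (use N(2) in auto)
qed

lemma upper_density_diagonal:
  assumes a: "\<And>i. \<exists>n\<ge>i. r \<notin> fails G x q (a n) (stage_end n (a n))"
    and q: "\<And>m. evals (join G x r) q [m] (of_bool (m \<in> B))"
  shows "upper_density (sym_diff {m. G (prod_encode (x, m)) r} B) = 1"
proof -
  let ?E = "sym_diff {m. G (prod_encode (x, m)) r} B"
  have "1 - inverse (real (Suc i)) \<le> upper_density ?E" for i
  proof (rule upper_density_geI)
    fix j
    obtain n where n: "n \<ge> max i j" "r \<notin> fails G x q (a n) (stage_end n (a n))"
      using a by blast
    let ?b = "stage_end n (a n)"
    have "{a n..<?b} \<subseteq> ?E \<inter> {0..<?b}" using n(2) q unfolding fails_def by auto
    from card_mono[OF _ this] have "?b - a n \<le> card (?E \<inter> {0..<?b})" by simp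
    then have "?b \<le> card (?E \<inter> {0..<?b}) + a n" by (simp only: le_diff_conv)
    \<comment> \<open>Weakening \<open>a n\<close> to \<open>Suc (a n)\<close> makes the quotient
      below exactly 1 - 1 / (n + 1).\<close>
    then have card: "real ?b - real (Suc (a n)) \<le> real (card (?E \<inter> {0..<?b}))" by linarith
    have "1 - inverse (real (Suc i)) \<le> 1 - inverse (real (Suc n))"
      using n(1) by (simp add: le_imp_inverse_le)
    also have "\<dots> = (real ?b - real (Suc (a n))) / real ?b"
      by (simp add: diff_divide_distrib inverse_eq_divide del: of_nat_Suc mult_Suc mult_Suc_right)
    also have "\<dots> \<le> density_upto ?b ?E"
      unfolding density_upto_def using card by (intro divide_right_mono) auto
    finally show "\<exists>l\<ge>j. 1 - inverse (real (Suc i)) \<le> density_upto l ?E"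
      using n(1) by (intro exI[of _ ?b]) auto
  qed
  moreover have "(\<lambda>i. 1 - inverse (real (Suc i))) \<longlonglongrightarrow> 1 - 0"
    by (intro tendsto_intros LIMSEQ_inverse_real_of_nat)
  ultimately have "1 \<le> upper_density ?E"
    by (intro LIMSEQ_le_const2[where a = "upper_density ?E"]) auto
  with upper_density_le_1[of ?E] show ?thesis by linarith
qed

text \<open>One coin sequence satisfies the countably many almost sure conditions for all
  \<open>x\<close> and \<open>q\<close>. The witness is column \<open>x\<close> of the oracle of
  \<open>y\<close>: a generic column if x < y, a coin column if they are incomparable.\<close>

lemma ex_degrees:
  "\<exists>E :: nat \<Rightarrow> nat set. \<forall>x y.
    (lt x y \<longrightarrow> (\<exists>A. A \<le>\<^sub>T E y \<and> (\<forall>B. B \<le>\<^sub>T E x \<longrightarrow> upper_density (sym_diff A B) = 1))) \<and>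
    (inc x y \<longrightarrow> (\<exists>A. A \<le>\<^sub>T E y \<and> (\<forall>B. B \<le>\<^sub>T E x \<longrightarrow> upper_density (sym_diff A B) = 1 / 2)))"
proof -
  obtain G where G: "legal G" and "\<forall>x q n. \<exists>a. \<exists>N\<in>sets coins.
     fails G x q a (stage_end n a) \<subseteq> N \<and> measure coins N < (1 / 2) ^ n"
    using ex_diagonal by blast
  then obtain a where a: "\<And>x q n. \<exists>N\<in>sets coins.
     fails G x q (a x q n) (stage_end n (a x q n)) \<subseteq> N \<and> measure coins N < (1 / 2) ^ n"
    by metis
  let ?R = "\<lambda>x q r. \<forall>i. \<exists>n\<ge>i. r \<notin> fails G x q (a x q n) (stage_end n (a x q n))"
  \<comment> \<open>Testing for output 1 assigns a set to every program, even a partial one; it is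
    \<open>B\<close> whenever \<open>q\<close> computes \<open>B\<close>.\<close>
  let ?C = "\<lambda>x q r. upper_density (sym_diff {m. r (prod_encode (x, m))}
    {m. evals (join G x r) q [m] 1}) = 1 / 2"
  have "AE r in coins. ?R x q r \<and> ?C x q r" for x q
  proof (rule AE_conjI)
    show "AE r in coins. ?R x q r" by (intro AE_infinitely_often_not_fails a)
    show "AE r in coins. ?C x q r"
    proof (rule AE_upper_density_half[where c = "\<lambda>m. prod_encode (x, m)"])
      show "inj (\<lambda>m. prod_encode (x, m))" by (auto intro: injI)
      note [measurable] = measurable_evals[OF measurable_join[OF G]]
      show "Measurable.pred coins (\<lambda>r. m \<in> {m. evals (join G x r) q [m] 1})" for m by simp
      have "join G x (flip (prod_encode (x, m)) r) = join G x r" for m r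
        by (intro join_cong G) (auto simp: flip_def)
      then show "{l. evals (join G x (flip (prod_encode (x, m)) r)) q [l] 1} =
          {l. evals (join G x r) q [l] 1}" for m r
        by simp
    qed
  qed
  then have "AE r in coins. \<forall>x q. ?R x q r \<and> ?C x q r"
    unfolding AE_all_countable by blast
  from eventually_happens'[OF coins.ae_filter_bot this]
  obtain r where r: "\<And>x q. ?R x q r" "\<And>x q. ?C x q r"
    by blast
  show ?thesis
  proof (intro exI[of _ "\<lambda>x. join G x r"] allI conjI impI)
    fix x y assume "lt x y"
    then have col: "column x (join G y r) = {m. G (prod_encode (x, m)) r}"
      by (auto simp: column_def join_def inc_def)
    show "\<exists>A. A \<le>\<^sub>T join G y r \<and> (\<forall>B. B \<le>\<^sub>T join G x r \<longrightarrow> upper_density (sym_diff A B) = 1)"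
    proof (intro exI conjI allI impI)
      show "column x (join G y r) \<le>\<^sub>T join G y r" by (rule column_turing_le)
      fix B assume "B \<le>\<^sub>T join G x r"
      then obtain q where "\<forall>m. evals (join G x r) q [m] (of_bool (m \<in> B))"
        unfolding turing_le_def by blast
      then show "upper_density (sym_diff (column x (join G y r)) B) = 1"
        unfolding col using r(1)[of x q] by (intro upper_density_diagonal[where q = q and a = "a x q"]) auto
    qed
  next
    fix x y assume "inc x y"
    then have col: "column x (join G y r) = {m. r (prod_encode (x, m))}"
      by (auto simp: column_def join_def inc_def)
    show "\<exists>A. A \<le>\<^sub>T join G y r \<and> (\<forall>B. B \<le>\<^sub>T join G x r \<longrightarrow> upper_density (sym_diff A B) = 1 / 2)"
    proof (intro exI conjI allI impI)
      show "column x (join G y r) \<le>\<^sub>T join G y r" by (rule column_turing_le)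
      fix B assume "B \<le>\<^sub>T join G x r"
      then obtain q where q: "\<forall>m. evals (join G x r) q [m] (of_bool (m \<in> B))"
        unfolding turing_le_def by blast
      have "evals (join G x r) q [m] 1 \<longleftrightarrow> m \<in> B" for m
        using evals_deterministic[OF q[rule_format, of m], of 1] q[rule_format, of m]
        by (cases "m \<in> B") auto
      then have "B = {m. evals (join G x r) q [m] 1}" by auto
      then show "upper_density (sym_diff (column x (join G y r)) B) = 1 / 2"
        unfolding col using r(2)[of x q] by simp
    qed
  qed
qed

end

section \<open>Distances between degrees\<close>

lemma deg_le_iff: "deg A \<le> deg B \<longleftrightarrow> A \<le>\<^sub>T B"
  by (rule less_eq_tdegree.abs_eq)

lemma dist_coarse_class_eq: "dist (coarse_class X) (coarse_class Y) = upper_density (sym_diff X Y)"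
  by (rule dist_coarse_class.abs_eq)

lemma infdist_closure_coarse_below_le_1: "infdist x (closure (coarse_below e)) \<le> 1"
proof -
  obtain y where "y \<in> closure (coarse_below e)"
    using coarse_below_nonempty closure_subset by blast
  then show ?thesis using dist_coarse_class_le_1 by (rule infdist_le2)
qed

text \<open>\<open>infdist\<close> is continuous, so a bound on the classes themselves extends to
  their closure.\<close>

lemma SUP_infdist_coarse_below_le:
  assumes "\<And>X. X \<le>\<^sub>T A \<Longrightarrow> \<exists>Y. Y \<le>\<^sub>T B \<and> upper_density (sym_diff X Y) \<le> c"
  shows "(SUP x\<in>closure (coarse_below (deg A)). infdist x (closure (coarse_below (deg B)))) \<le> c"
proof (rule cSUP_least)
  show "closure (coarse_below (deg A)) \<noteq> {}" using coarse_below_nonempty by simp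
  let ?S = "{x. infdist x (closure (coarse_below (deg B))) \<le> c}"
  have "closed ?S" by (intro closed_Collect_le continuous_intros)
  moreover have "coarse_below (deg A) \<subseteq> ?S"
  proof
    fix x assume "x \<in> coarse_below (deg A)"
    then obtain X where X: "x = coarse_class X" "X \<le>\<^sub>T A"
      by (auto simp: coarse_below_def deg_le_iff)
    from assms[OF X(2)] obtain Y where Y: "Y \<le>\<^sub>T B" "upper_density (sym_diff X Y) \<le> c" by blast
    have "coarse_class Y \<in> closure (coarse_below (deg B))"
      using Y(1) closure_subset by (force simp: coarse_below_def deg_le_iff)
    then show "x \<in> ?S"
      using Y(2) infdist_le2[of "coarse_class Y" _ x c] by (simp add: X(1) dist_coarse_class_eq)
  qed
  ultimately have "closure (coarse_below (deg A)) \<subseteq> ?S" by (rule closure_minimal[rotated])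
  then show "infdist x (closure (coarse_below (deg B))) \<le> c"
    if "x \<in> closure (coarse_below (deg A))" for x
    using that by blast
qed

text \<open>The distance from the class of \<open>X\<close> is continuous, so the lower bound
  survives closing the other set; this one class then bounds the supremum.\<close>

lemma le_SUP_infdist_coarse_below:
  assumes "X \<le>\<^sub>T A" and "\<And>Y. Y \<le>\<^sub>T B \<Longrightarrow> c \<le> upper_density (sym_diff X Y)"
  shows "c \<le> (SUP x\<in>closure (coarse_below (deg A)). infdist x (closure (coarse_below (deg B))))"
proof -
  have "closed {y. c \<le> dist (coarse_class X) y}" by (intro closed_Collect_le continuous_intros)
  moreover have "coarse_below (deg B) \<subseteq> {y. c \<le> dist (coarse_class X) y}"
    using assms(2) by (auto simp: coarse_below_def deg_le_iff dist_coarse_class_eq)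
  ultimately have "closure (coarse_below (deg B)) \<subseteq> {y. c \<le> dist (coarse_class X) y}"
    by (rule closure_minimal[rotated])
  then have "c \<le> infdist (coarse_class X) (closure (coarse_below (deg B)))"
    using coarse_below_nonempty[of "deg B"]
    by (subst infdist_notempty) (auto intro!: cINF_greatest)
  also have "\<dots> \<le> (SUP x\<in>closure (coarse_below (deg A)). infdist x (closure (coarse_below (deg B))))"
  proof (rule cSUP_upper)
    show "coarse_class X \<in> closure (coarse_below (deg A))"
      using assms(1) closure_subset by (force simp: coarse_below_def deg_le_iff)
    show "bdd_above ((\<lambda>x. infdist x (closure (coarse_below (deg B)))) ` closure (coarse_below (deg A)))"
      by (intro bdd_aboveI[of _ 1]) (auto simp: infdist_closure_coarse_below_le_1)
  qed
  finally show ?thesis .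
qed

lemma degree_dist_commute: "degree_dist d e = degree_dist e d"
  by (simp add: degree_dist_def hausdorff_dist_def max.commute)

lemma degree_dist_self: "degree_dist d d = 0"
proof -
  have "(SUP x\<in>closure (coarse_below d). infdist x (closure (coarse_below d))) =
      (SUP x\<in>closure (coarse_below d). 0)"
    by (intro SUP_cong) auto
  also have "\<dots> = 0" using coarse_below_nonempty[of d] by (intro cSUP_const) simp
  finally show ?thesis by (simp add: degree_dist_def hausdorff_dist_def)
qed

text \<open>Separation on one side suffices because no distance exceeds 1.\<close>

lemma degree_dist_eq_1:
  assumes "X \<le>\<^sub>T B" and "\<And>Y. Y \<le>\<^sub>T A \<Longrightarrow> upper_density (sym_diff X Y) = 1"
  shows "degree_dist (deg A) (deg B) = 1"
proof -
  have "degree_dist (deg A) (deg B) \<le> 1"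
    unfolding degree_dist_def hausdorff_dist_def
    using turing_le_refl upper_density_le_1
    by (intro max.boundedI SUP_infdist_coarse_below_le) blast+
  moreover have "1 \<le> degree_dist (deg A) (deg B)"
    unfolding degree_dist_def hausdorff_dist_def
    using le_SUP_infdist_coarse_below[OF assms(1), of A 1] assms(2) by (simp add: le_max_iff_disj)
  ultimately show ?thesis by simp
qed

text \<open>The witnesses also give the upper bound: \<open>X\<close> lies at distance 1/2 from
  everything below \<open>A\<close>, so it approximates every such set that well, and
  \<open>X'\<close> does the same for the sets below \<open>B\<close>.\<close>

lemma degree_dist_eq_half:
  assumes "X \<le>\<^sub>T B" and "\<And>Y. Y \<le>\<^sub>T A \<Longrightarrow> upper_density (sym_diff X Y) = 1 / 2"
    and "X' \<le>\<^sub>T A" and "\<And>Y. Y \<le>\<^sub>T B \<Longrightarrow> upper_density (sym_diff X' Y) = 1 / 2"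
  shows "degree_dist (deg A) (deg B) = 1 / 2"
proof -
  have "degree_dist (deg A) (deg B) \<le> 1 / 2"
    unfolding degree_dist_def hausdorff_dist_def
  proof (intro max.boundedI SUP_infdist_coarse_below_le)
    show "\<exists>Y. Y \<le>\<^sub>T B \<and> upper_density (sym_diff Z Y) \<le> 1 / 2" if "Z \<le>\<^sub>T A" for Z
      using assms(1) assms(2)[OF that] by (intro exI[of _ X]) (simp add: Un_commute)
    show "\<exists>Y. Y \<le>\<^sub>T A \<and> upper_density (sym_diff Z Y) \<le> 1 / 2" if "Z \<le>\<^sub>T B" for Z
      using assms(3) assms(4)[OF that] by (intro exI[of _ X']) (simp add: Un_commute)
  qed
  moreover have "1 / 2 \<le> degree_dist (deg A) (deg B)"
    unfolding degree_dist_def hausdorff_dist_def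
    using le_SUP_infdist_coarse_below[OF assms(1), of A "1 / 2"] assms(2) by (simp add: le_max_iff_disj)
  ultimately show ?thesis by simp
qed

theorem theorem6p1:
  fixes M :: "'a set" and d :: "'a \<Rightarrow> 'a \<Rightarrow> real"
  assumes "Metric_space M d"
    and "countable M"
    and "\<forall>x\<in>M. \<forall>y\<in>M. d x y \<in> {0, 1 / 2, 1}"
    and "comparability_graph (distance_one_graph M d)"
  shows "\<exists>f. isometric_embedding M d (UNIV :: tdegree set) degree_dist f"
proof -
  interpret Metric_space M d by fact
  from assms(4) obtain r where po: "partial_order_on M r"
    and r: "\<And>x y. x \<in> M \<Longrightarrow> y \<in> M \<Longrightarrow> d x y = 1 \<longleftrightarrow> x \<noteq> y \<and> ((x, y) \<in> r \<or> (y, x) \<in> r)"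
    by (auto simp: comparability_graph_def distance_one_graph_def)
  let ?c = "to_nat_on M"
  have c: "?c x = ?c y \<longleftrightarrow> x = y" if "x \<in> M" "y \<in> M" for x y
    using that assms(2) by simp
  \<comment> \<open>The order is carried over to codes; numbers coding no point of \<open>M\<close>
    are incomparable to all others.\<close>
  define lt where "lt i j \<longleftrightarrow> (\<exists>x\<in>M. \<exists>y\<in>M. i = ?c x \<and> j = ?c y \<and> x \<noteq> y \<and> (x, y) \<in> r)" for i j
  have tr: "trans r" and an: "antisym r"
    using po by (auto simp: partial_order_on_def preorder_on_def)
  interpret strict_order lt
  proof
    show "\<not> lt i i" for i using c by (auto simp: lt_def)
    show "lt i k" if "lt i j" "lt j k" for i j k
    proof -
      from that(1) obtain x y where xy: "x \<in> M" "y \<in> M" "i = ?c x" "j = ?c y" "x \<noteq> y" "(x, y) \<in> r"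
        unfolding lt_def by blast
      from that(2) obtain y' z where z: "y' \<in> M" "z \<in> M" "j = ?c y'" "k = ?c z" "y' \<noteq> z" "(y', z) \<in> r"
        unfolding lt_def by blast
      have "y' = y" using xy z c by simp
      then have "(x, z) \<in> r" "x \<noteq> z"
        using xy z transD[OF tr] antisymD[OF an] by blast+
      then show ?thesis unfolding lt_def using xy z by blast
    qed
  qed
  have lt: "lt (?c x) (?c y) \<longleftrightarrow> x \<noteq> y \<and> (x, y) \<in> r" if "x \<in> M" "y \<in> M" for x y
    unfolding lt_def using that c by auto
  obtain E :: "nat \<Rightarrow> nat set" where
    E1: "\<And>i j. lt i j \<Longrightarrow> \<exists>A. A \<le>\<^sub>T E j \<and> (\<forall>B. B \<le>\<^sub>T E i \<longrightarrow> upper_density (sym_diff A B) = 1)" and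
    E2: "\<And>i j. inc i j \<Longrightarrow> \<exists>A. A \<le>\<^sub>T E j \<and> (\<forall>B. B \<le>\<^sub>T E i \<longrightarrow> upper_density (sym_diff A B) = 1 / 2)"
    using ex_degrees by blast
  have dist1: "degree_dist (deg (E i)) (deg (E j)) = 1" if "lt i j" for i j
    using E1[OF that] degree_dist_eq_1 by blast
  have dist2: "degree_dist (deg (E i)) (deg (E j)) = 1 / 2" if "inc i j" for i j
  proof -
    have "inc j i" using that by (auto simp: inc_def)
    with E2[OF that] E2[OF this] show ?thesis using degree_dist_eq_half by metis
  qed
  have "degree_dist (deg (E (?c x))) (deg (E (?c y))) = d x y" if "x \<in> M" "y \<in> M" for x y
  proof -
    have c_eq: "?c x = ?c y \<longleftrightarrow> x = y" using c that by blast
    consider "x = y" | "lt (?c x) (?c y)" | "lt (?c y) (?c x)" | "inc (?c x) (?c y)"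
      using c_eq by (auto simp: inc_def)
    then show ?thesis
    proof cases
      case 1
      then show ?thesis using that by (simp add: degree_dist_self)
    next
      case 2
      then show ?thesis using dist1 r[OF that] lt[OF that] by simp
    next
      case 3
      then show ?thesis using dist1[OF 3] r[OF that] lt[OF that(2) that(1)]
        by (auto simp: degree_dist_commute)
    next
      case 4
      then have "x \<noteq> y" "d x y \<noteq> 1"
        using r[OF that] lt[OF that] lt[OF that(2) that(1)] by (auto simp: inc_def)
      then have "d x y = 1 / 2" using assms(3) that zero[OF that] by auto
      then show ?thesis using dist2[OF 4] by simp
    qed
  qed
  then show ?thesis
    unfolding isometric_embedding_def by (intro exI[of _ "\<lambda>x. deg (E (?c x))"]) auto
qed

end
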